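(* Let $E$ be a Banach space and let $E_1,E_2$ be two subspaces of $E$ with $\dim E_1=\dim E_2<\infty$. Then $E_1$ and $E_2$ possess a common complement $R$, i.e. there is a subspace $R$ of $E$ with $E=E_1\oplus R=E_2\oplus R$.
   Context: Decompositions $E=A\oplus B$ are topological direct sums of closed subspaces; in particular the complement $R$ is a closed subspace of $E$. *)

theory Defs
  imports "HOL-Analysis.Analysis"
begin

text \<open>
  A Banach space over \<open>K\<close>, where \<open>K\<close> is the field of real or of complex numbers.  By Frobenius'
  theorem these are, up to isomorphism, the only types in both \<^class>\<open>real_normed_field\<close> and
  \<^class>\<open>euclidean_space\<close>.  Completeness comes from the class \<^class>\<open>banach\<close>, which also provides
  the underlying real vector space; the axiom \<open>scale_of_real\<close> says that \<open>scale\<close> extends it.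
\<close>

locale banach_space_over = vector_space scale
  for scale :: "'k::{real_normed_field,euclidean_space} \<Rightarrow> 'e::banach \<Rightarrow> 'e" +
  assumes scale_of_real: "scale (of_real r) x = r *\<^sub>R x"
    and norm_scale: "norm (scale c x) = norm c * norm x"
begin

text \<open>Needed because \<open>dim\<close> is \<open>0\<close> on subspaces of infinite dimension.\<close>

definition finite_dimensional_subspace :: "'e set \<Rightarrow> bool" where
  "finite_dimensional_subspace V \<longleftrightarrow> subspace V \<and> (\<exists>B. finite B \<and> span B = V)"

text \<open>
  \<open>E = A \<oplus> B\<close> as a topological direct sum of closed subspaces: addition \<open>A \<times> B \<rightarrow> E\<close> is a
  homeomorphism.  Its bijectivity is the algebraic direct sum decomposition.
\<close>

definition topological_direct_sum :: "'e set \<Rightarrow> 'e set \<Rightarrow> bool" where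
  "topological_direct_sum A B \<longleftrightarrow>
     subspace A \<and> subspace B \<and> closed A \<and> closed B \<and>
     (\<exists>g. homeomorphism (A \<times> B) UNIV (\<lambda>(a, b). a + b) g)"

lemma topological_direct_sum_algebraic:
  assumes "topological_direct_sum A B"
  shows "A \<inter> B = {0}" and "{a + b |a b. a \<in> A \<and> b \<in> B} = UNIV"
proof -
  obtain g where g: "homeomorphism (A \<times> B) UNIV (\<lambda>(a, b). a + b) g"
    and sub: "subspace A" "subspace B"
    using assms unfolding topological_direct_sum_def by blast
  have inj: "g (a + b) = (a, b)" if "a \<in> A" "b \<in> B" for a b
    using g that unfolding homeomorphism_def by force
  have "x = 0" if "x \<in> A" "x \<in> B" for x
    using inj[of x 0] inj[of 0 x] that sub by (auto simp: subspace_0)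
  then show "A \<inter> B = {0}"
    using sub by (auto simp: subspace_0)
  have "(\<lambda>(a, b). a + b) ` (A \<times> B) = UNIV"
    using g unfolding homeomorphism_def by blast
  then show "{a + b |a b. a \<in> A \<and> b \<in> B} = UNIV"
    by (simp add: image_def set_eq_iff) metis
qed

end

lemma banach_space_over_real:
  "banach_space_over (scaleR :: real \<Rightarrow> 'e::banach \<Rightarrow> 'e)"
  by unfold_locales (auto simp: algebra_simps)

lemma banach_space_over_complex:
  "banach_space_over ((*) :: complex \<Rightarrow> complex \<Rightarrow> complex)"
  by unfold_locales (auto simp: algebra_simps norm_mult scaleR_conv_of_real)

end

theory Submission
  imports Defs
begin

text \<open>
  A continuous linear functional \<open>F\<close> that vanishes identically on neither \<open>E\<^sub>1\<close> nor \<open>E\<^sub>2\<close> reduces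
  the claim to the hyperplane \<open>ker F\<close>: both \<open>E\<^sub>i \<inter> ker F\<close> have dimension one less
  (\<open>dim_Int_kernel\<close>), and a common complement of them in \<open>ker F\<close> is a common complement of \<open>E\<^sub>1\<close> and
  \<open>E\<^sub>2\<close> in the whole space, since a vector \<open>v \<in> E\<^sub>i\<close> with \<open>F v \<noteq> 0\<close> supplies the missing direction
  (\<open>complement_in_extend\<close>).  Hence a common complement is found by induction on the dimension
  (\<open>common_complement_in\<close>), as an intersection of finitely many kernels.

  Closedness and continuity cost nothing on the way.  The complement is closed because the kernels
  are, and each step expresses the new projection through \<open>F\<close> and the old projection, so that it is
  continuous.  Continuity of the projection is what turns the algebraic decomposition into a
  topological one; the open mapping theorem is avoided.

  The functional comes from the Hahn-Banach theorem: for \<open>v\<^sub>i \<in> E\<^sub>i - {0}\<close> there are functionals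
  \<open>F\<^sub>i\<close> with \<open>F\<^sub>i v\<^sub>i \<noteq> 0\<close>, and one of \<open>F\<^sub>1\<close>, \<open>F\<^sub>2\<close>, \<open>F\<^sub>1 + F\<^sub>2\<close> is nonzero at both vectors.  A real
  functional of norm one is obtained as a minimal sublinear functional, and it is lifted to the
  scalar field by nondegeneracy of the form \<open>(a, b) \<mapsto> (a * b) \<bullet> 1\<close>.
\<close>

section \<open>Norm-attaining real functionals\<close>

text \<open>
  The inequality for \<open>c > 0\<close> already forces equality, as the scaling by \<open>c\<close> can be undone.
\<close>

definition sublinear :: "('a::real_vector \<Rightarrow> real) \<Rightarrow> bool" where
  "sublinear p \<longleftrightarrow> (\<forall>x y. p (x + y) \<le> p x + p y) \<and> (\<forall>c>0. \<forall>x. p (c *\<^sub>R x) \<le> c * p x)"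

lemma sublinear_add: "sublinear p \<Longrightarrow> p (x + y) \<le> p x + p y"
  by (simp add: sublinear_def)

lemma sublinear_0:
  assumes "sublinear p"
  shows "p 0 = 0"
proof -
  have "p ((1/2) *\<^sub>R 0) \<le> (1/2) * p 0"
    using assms unfolding sublinear_def by (metis half_gt_zero zero_less_one)
  moreover have "p (0 + 0) \<le> p 0 + p 0"
    using assms by (rule sublinear_add)
  ultimately show ?thesis by simp
qed

lemma sublinear_scale:
  assumes "sublinear p" "c \<ge> 0"
  shows "p (c *\<^sub>R x) = c * p x"
proof (cases "c = 0")
  case True
  then show ?thesis using sublinear_0[OF assms(1)] by simp
next
  case False
  then have c: "c > 0" using assms by simp
  have "p (inverse c *\<^sub>R (c *\<^sub>R x)) \<le> inverse c * p (c *\<^sub>R x)"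
    using assms(1) c unfolding sublinear_def by (meson positive_imp_inverse_positive)
  then have "p x \<le> p (c *\<^sub>R x) / c"
    using c by (simp add: divide_inverse mult.commute)
  then have "c * p x \<le> p (c *\<^sub>R x)"
    using c by (simp add: pos_le_divide_eq mult.commute)
  moreover have "p (c *\<^sub>R x) \<le> c * p x"
    using assms(1) c unfolding sublinear_def by blast
  ultimately show ?thesis by simp
qed

lemma sublinear_lower: "sublinear p \<Longrightarrow> - p (- x) \<le> p x"
  using sublinear_add[of p x "- x"] sublinear_0[of p] by simp

text \<open>
  A sublinear functional can be pushed down to be as small at \<open>- y\<close> as a linear functional with the
  value \<open>p y\<close> at \<open>y\<close> would be.  This both fixes the value of a functional at a prescribed vector and
  shows that minimal sublinear functionals are linear.
\<close>

lemma sublinear_decrease: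
  assumes p: "sublinear p"
  obtains q where "sublinear q" "q \<le> p" "q (- y) \<le> - p y"
proof -
  define f where "f x t = p (x + t *\<^sub>R y) - t * p y" for x t
  define q where "q x = (INF t\<in>{0..}. f x t)" for x
  have low: "- p (- x) \<le> f x t" if "t \<ge> 0" for x t
    using sublinear_add[OF p, of "x + t *\<^sub>R y" "- x"] sublinear_scale[OF p that, of y]
    unfolding f_def by simp
  have bdd: "bdd_below (f x ` {0..})" for x
    using low by (intro bdd_belowI2[where m = "- p (- x)"]) auto
  have q_le: "q x \<le> f x t" if "t \<ge> 0" for x t
    unfolding q_def using bdd that by (intro cINF_lower) auto
  have le_q: "a \<le> q x" if "\<And>t. t \<ge> 0 \<Longrightarrow> a \<le> f x t" for a x
    unfolding q_def using that by (intro cINF_greatest) auto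
  have add: "q (x + z) \<le> q x + q z" for x z
  proof -
    have "q (x + z) \<le> f x s + f z t" if "s \<ge> 0" "t \<ge> 0" for s t
    proof -
      have "q (x + z) \<le> f (x + z) (s + t)" using that by (intro q_le) simp
      also have "\<dots> \<le> f x s + f z t"
        using sublinear_add[OF p, of "x + s *\<^sub>R y" "z + t *\<^sub>R y"]
        unfolding f_def by (simp add: algebra_simps)
      finally show ?thesis .
    qed
    then have "q (x + z) - f x s \<le> q z" if "s \<ge> 0" for s
      using that by (intro le_q) (simp add: algebra_simps)
    then have "q (x + z) - q z \<le> q x"
      by (intro le_q) (simp add: algebra_simps)
    then show ?thesis by simp
  qed
  have scale: "q (c *\<^sub>R x) \<le> c * q x" if c: "c > 0" for c x
  proof -
    have "q (c *\<^sub>R x) / c \<le> f x t" if "t \<ge> 0" for t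
    proof -
      have "q (c *\<^sub>R x) \<le> f (c *\<^sub>R x) (c * t)" using c that by (intro q_le) simp
      also have "\<dots> = c * f x t"
        using sublinear_scale[OF p, of c "x + t *\<^sub>R y"] c
        unfolding f_def by (simp add: algebra_simps)
      finally show ?thesis using c by (simp add: pos_divide_le_eq mult.commute)
    qed
    then have "q (c *\<^sub>R x) / c \<le> q x" by (rule le_q)
    then show ?thesis using c by (simp add: pos_divide_le_eq mult.commute)
  qed
  show thesis
  proof
    show "sublinear q" using add scale by (simp add: sublinear_def)
    show "q \<le> p" using q_le[of 0] by (auto simp: le_fun_def f_def)
    show "q (- y) \<le> - p y"
      using q_le[of 1 "- y"] sublinear_0[OF p] by (simp add: f_def)
  qed
qed

lemma sublinear_minimal_below:
  fixes p :: "'a::real_vector \<Rightarrow> real"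
  assumes p: "sublinear p"
  obtains m where "sublinear m" "m \<le> p" "\<And>q. sublinear q \<Longrightarrow> q \<le> m \<Longrightarrow> q = m"
proof -
  define A where "A = {q. sublinear q \<and> q \<le> p}"
  have "\<exists>m\<in>A. \<forall>q\<in>A. m \<ge> q \<longrightarrow> q = m"
  proof (rule predicate_Zorn)
    show "partial_order_on A (relation_of (\<ge>) A)"
      by (rule partial_order_on_relation_ofI) auto
  next
    fix C assume C: "C \<in> Chains (relation_of (\<ge>) A)"
    then have CA: "C \<subseteq> A" and chain: "\<And>f g. f \<in> C \<Longrightarrow> g \<in> C \<Longrightarrow> f \<le> g \<or> g \<le> f"
      by (auto simp: Chains_def relation_of_def)
    show "\<exists>u\<in>A. \<forall>q\<in>C. q \<ge> u"
    proof (cases "C = {}")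
      case True
      then show ?thesis using p by (auto simp: A_def)
    next
      case False
      define u where "u x = (INF q\<in>C. q x)" for x
      have low: "- p (- x) \<le> q x" if "q \<in> C" for q x
      proof -
        have "sublinear q" "q (- x) \<le> p (- x)" using that CA by (auto simp: A_def le_fun_def)
        then show ?thesis using sublinear_lower[of q x] by linarith
      qed
      have u_le: "u x \<le> q x" if "q \<in> C" for q x
        unfolding u_def using low that by (intro cINF_lower bdd_belowI2[where m = "- p (- x)"]) auto
      have le_u: "a \<le> u x" if "\<And>q. q \<in> C \<Longrightarrow> a \<le> q x" for a x
        unfolding u_def using that False by (intro cINF_greatest) auto
      have sub: "sublinear q" if "q \<in> C" for q using that CA by (auto simp: A_def)
      have add: "u (x + z) \<le> u x + u z" for x z
      proof -
        have "u (x + z) \<le> f x + g z" if fg: "f \<in> C" "g \<in> C" for f g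
        proof -
          \<comment> \<open>The smaller of two members of the chain bounds both terms.\<close>
          obtain h where h: "h \<in> C" "h \<le> f" "h \<le> g"
            using chain[OF fg] fg by blast
          have "u (x + z) \<le> h x + h z"
            using u_le[OF h(1), of "x + z"] sublinear_add[OF sub[OF h(1)], of x z] by linarith
          also have "\<dots> \<le> f x + g z" using h by (intro add_mono) (auto simp: le_fun_def)
          finally show ?thesis .
        qed
        then have "u (x + z) - f x \<le> g z" if "f \<in> C" "g \<in> C" for f g
          using that by (simp add: algebra_simps)
        then have "u (x + z) - f x \<le> u z" if "f \<in> C" for f
          using that by (intro le_u)
        then have "u (x + z) - u z \<le> u x"
          by (intro le_u) (simp add: algebra_simps)
        then show ?thesis by simp
      qed
      have scale: "u (c *\<^sub>R x) \<le> c * u x" if c: "c > 0" for c x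
      proof -
        have "u (c *\<^sub>R x) / c \<le> q x" if "q \<in> C" for q
          using u_le[OF that, of "c *\<^sub>R x"] sublinear_scale[OF sub[OF that], of c x] c
          by (simp add: pos_divide_le_eq mult.commute)
        then have "u (c *\<^sub>R x) / c \<le> u x" by (rule le_u)
        then show ?thesis using c by (simp add: pos_divide_le_eq mult.commute)
      qed
      obtain q where "q \<in> C" using False by blast
      then have "u \<le> q" "q \<le> p" using u_le CA by (auto simp: A_def le_fun_def)
      then have "u \<le> p" by (rule order_trans)
      then have "u \<in> A" using add scale by (simp add: A_def sublinear_def)
      then show ?thesis using u_le by (auto simp: le_fun_def)
    qed
  qed
  then obtain m where m: "m \<in> A" "\<And>q. q \<in> A \<Longrightarrow> q \<le> m \<Longrightarrow> q = m" by blast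
  show thesis
  proof
    show "sublinear m" "m \<le> p" using m(1) by (auto simp: A_def)
    show "q = m" if "sublinear q" "q \<le> m" for q
      using that m by (auto simp: A_def intro: order_trans)
  qed
qed

text \<open>
  This is the Hahn-Banach theorem in a form free of partially defined functionals: instead of
  extending, one decreases the sublinear bound until nothing is left to decrease.
\<close>

lemma linear_below_sublinear:
  fixes p :: "'a::real_vector \<Rightarrow> real"
  assumes p: "sublinear p"
  obtains g where "linear g" "g \<le> p" "g v = p v"
proof -
  obtain q where q: "sublinear q" "q \<le> p" "q (- v) \<le> - p v"
    using sublinear_decrease[OF p] by blast
  obtain g where g: "sublinear g" "g \<le> q" and min: "\<And>r. sublinear r \<Longrightarrow> r \<le> g \<Longrightarrow> r = g"
    using sublinear_minimal_below[OF q(1)] by blast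
  have minus: "g (- y) = - g y" for y
  proof -
    obtain r where "sublinear r" "r \<le> g" "r (- y) \<le> - g y"
      using sublinear_decrease[OF g(1)] by blast
    then have "g (- y) \<le> - g y" using min by blast
    then show ?thesis using sublinear_lower[OF g(1), of "- y"] by simp
  qed
  have add: "g (x + y) = g x + g y" for x y
    using sublinear_add[OF g(1), of x y] sublinear_add[OF g(1), of "x + y" "- y"] minus[of y]
    by simp
  have scale: "g (c *\<^sub>R x) = c *\<^sub>R g x" for c x
  proof (cases "c \<ge> 0")
    case True
    then show ?thesis using sublinear_scale[OF g(1)] by simp
  next
    case False
    then have "g (- ((- c) *\<^sub>R x)) = - (- c * g x)"
      unfolding minus using sublinear_scale[OF g(1), of "- c" x] by simp
    then show ?thesis by simp
  qed
  show thesis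
  proof
    show "linear g" using add scale by (rule linearI)
    show "g \<le> p" using g(2) q(2) by (rule order_trans)
    then have "g v \<le> p v" by (simp add: le_fun_def)
    moreover have "g (- v) \<le> - p v" using g(2) q(3) by (auto simp: le_fun_def intro: order_trans)
    ultimately show "g v = p v" using minus[of v] by simp
  qed
qed

lemma norming_real_functional:
  fixes v :: "'a::real_normed_vector"
  obtains g where "linear g" "\<And>x. g x \<le> norm x" "g v = norm v"
proof -
  have "sublinear (norm :: 'a \<Rightarrow> real)"
    by (simp add: sublinear_def norm_triangle_ineq)
  then show thesis
    using linear_below_sublinear[of norm v] that by (auto simp: le_fun_def)
qed

section \<open>Functionals over the scalar field\<close>

text \<open>
  The form \<open>(a, b) \<mapsto> (a * b) \<bullet> 1\<close> on a finite-dimensional field extension of the reals is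
  nondegenerate, because \<open>b \<noteq> 0\<close> pairs with its inverse to \<open>1 \<bullet> 1 \<noteq> 0\<close>.  It therefore represents
  every real functional on the field, uniquely.
\<close>

lemma scalar_form_cancel:
  fixes y z :: "'k::{real_normed_field,euclidean_space}"
  assumes "\<And>a. (a * y) \<bullet> 1 = (a * z) \<bullet> 1"
  shows "y = z"
proof (rule ccontr)
  assume "y \<noteq> z"
  moreover have "(inverse (y - z) * (y - z)) \<bullet> 1 = 0"
    using assms[of "inverse (y - z)"] by (simp only: right_diff_distrib inner_diff_left)
  ultimately show False by simp
qed

lemma scalar_form_represents:
  fixes \<phi> :: "'k::{real_normed_field,euclidean_space} \<Rightarrow> real"
  assumes "linear \<phi>"
  shows "\<exists>y. \<forall>a. (a * y) \<bullet> 1 = \<phi> a"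
proof -
  define T :: "'k \<Rightarrow> 'k" where "T y = (\<Sum>b\<in>Basis. ((b * y) \<bullet> 1) *\<^sub>R b)" for y
  have T: "T y \<bullet> b = (b * y) \<bullet> 1" if "b \<in> Basis" for b y
    unfolding T_def using that by (rule inner_sum_left_Basis)
  have lin_form: "linear (\<lambda>a. (a * y) \<bullet> 1)" for y :: 'k
    by (rule linearI) (simp_all add: distrib_right inner_add_left)
  have "linear T"
    by (rule linearI) (simp_all add: T_def distrib_left inner_add_left scaleR_add_left
        sum.distrib scaleR_sum_right)
  moreover have "inj T"
  proof (rule injI)
    fix y z assume "T y = T z"
    then have "(b * y) \<bullet> 1 = (b * z) \<bullet> 1" if "b \<in> Basis" for b :: 'k
      using T[OF that, of y] T[OF that, of z] by simp
    then have "(\<lambda>a. (a * y) \<bullet> 1) = (\<lambda>a. (a * z) \<bullet> 1)"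
      by (intro linear_eq_stdbasis lin_form) auto
    then have "(a * y) \<bullet> 1 = (a * z) \<bullet> 1" for a
      unfolding fun_eq_iff by blast
    then show "y = z" by (rule scalar_form_cancel)
  qed
  ultimately have "surj T"
    by (rule linear_inj_imp_surj)
  then obtain y where y: "(\<Sum>b\<in>Basis. \<phi> b *\<^sub>R b) = T y"
    by (rule surjE)
  have "(b * y) \<bullet> 1 = \<phi> b" if "b \<in> Basis" for b
    unfolding T[OF that, symmetric] y[symmetric] using that by (rule inner_sum_left_Basis)
  then have "(\<lambda>a. (a * y) \<bullet> 1) = \<phi>"
    by (intro linear_eq_stdbasis lin_form assms) auto
  then show ?thesis unfolding fun_eq_iff by blast
qed

context banach_space_over
begin

definition continuous_functional :: "('e \<Rightarrow> 'k) \<Rightarrow> bool" where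
  "continuous_functional F \<longleftrightarrow>
     (\<forall>x y. F (x + y) = F x + F y) \<and> (\<forall>c x. F (scale c x) = c * F x) \<and> continuous_on UNIV F"

lemma continuous_functionalD:
  assumes "continuous_functional F"
  shows "F (x + y) = F x + F y" "F (scale c x) = c * F x" "continuous_on UNIV F"
    "F 0 = 0" "F (x - y) = F x - F y"
proof -
  show *: "F (x + y) = F x + F y" "F (scale c x) = c * F x" "continuous_on UNIV F" for x y c
    using assms by (auto simp: continuous_functional_def)
  show "F 0 = 0" using *(1)[of 0 0] by simp
  show "F (x - y) = F x - F y" using *(1)[of "x - y" y] by simp
qed

lemma continuous_functional_add:
  "continuous_functional F \<Longrightarrow> continuous_functional G \<Longrightarrow> continuous_functional (\<lambda>x. F x + G x)"
  unfolding continuous_functional_def by (auto simp: algebra_simps intro: continuous_on_add)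

text \<open>
  Over the complex numbers this is the classical passage from a real functional \<open>g\<close> to
  \<open>x \<mapsto> g x - \<i> * g (\<i> * x)\<close>.  Here \<open>F x\<close> is the scalar that represents \<open>a \<mapsto> g (scale a x)\<close>.
\<close>

lemma ex_continuous_functional:
  assumes "v \<noteq> 0"
  obtains F where "continuous_functional F" "F v \<noteq> 0"
proof -
  obtain g :: "'e \<Rightarrow> real" where g: "linear g" "\<And>x. g x \<le> norm x" "g v = norm v"
    using norming_real_functional[of v] by blast
  have "linear (\<lambda>a. g (scale a x))" for x
  proof (rule linearI)
    fix a b r
    show "g (scale (a + b) x) = g (scale a x) + g (scale b x)"
      by (simp add: scale_left_distrib linear_add[OF g(1)])
    have "scale (r *\<^sub>R a) x = r *\<^sub>R scale a x"
      by (simp add: scaleR_conv_of_real flip: scale_scale scale_of_real)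
    then show "g (scale (r *\<^sub>R a) x) = r *\<^sub>R g (scale a x)"
      by (simp add: linear_scale[OF g(1)])
  qed
  then have "\<forall>x. \<exists>y. \<forall>a. (a * y) \<bullet> 1 = g (scale a x)"
    using scalar_form_represents by blast
  then obtain F where F: "(a * F x) \<bullet> 1 = g (scale a x)" for x a
    using choice by meson
  have add: "F (x + y) = F x + F y" for x y
    by (rule scalar_form_cancel)
      (simp add: F distrib_left inner_add_left scale_right_distrib linear_add[OF g(1)])
  have scale: "F (scale c x) = c * F x" for c x
  proof (rule scalar_form_cancel)
    fix a
    show "(a * F (scale c x)) \<bullet> 1 = (a * (c * F x)) \<bullet> 1"
      using F[of "a * c" x] by (simp add: F mult.assoc)
  qed
  have bound: "norm (F x) \<le> norm x" for x
  proof (cases "F x = 0")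
    case False
    \<comment> \<open>Rotating and rescaling \<open>x\<close> so that \<open>F\<close> takes the value 1 reduces to the bound on \<open>g\<close>.\<close>
    then have "(inverse (F x) * F x) \<bullet> 1 = 1"
      by (simp add: dot_square_norm)
    then have "1 = g (scale (inverse (F x)) x)" by (simp only: F)
    also have "\<dots> \<le> norm x / norm (F x)"
      using g(2)[of "scale (inverse (F x)) x"] by (simp add: norm_scale norm_inverse divide_inverse mult.commute)
    finally show ?thesis using False by (simp add: field_simps)
  qed simp
  have "bounded_linear F"
  proof (rule bounded_linear_intro[where K = 1])
    show "F (r *\<^sub>R x) = r *\<^sub>R F x" for r x
      using scale[of "of_real r" x] by (simp add: scale_of_real scaleR_conv_of_real)
  qed (use add bound in auto)
  then have "continuous_functional F"
    using add scale by (simp add: continuous_functional_def linear_continuous_on)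
  moreover have "F v \<noteq> 0"
    using F[of 1 v] g(3) assms by auto
  ultimately show thesis by (rule that)
qed

lemma ex_continuous_functional_two:
  assumes "v \<noteq> 0" "w \<noteq> 0"
  obtains F where "continuous_functional F" "F v \<noteq> 0" "F w \<noteq> 0"
proof -
  obtain F where F: "continuous_functional F" "F v \<noteq> 0"
    using ex_continuous_functional[OF assms(1)] .
  obtain G where G: "continuous_functional G" "G w \<noteq> 0"
    using ex_continuous_functional[OF assms(2)] .
  \<comment> \<open>If neither \<open>F\<close> nor \<open>G\<close> serves, then \<open>F w = 0\<close> and \<open>G v = 0\<close>, so the sum does.\<close>
  show thesis
    using F G continuous_functional_add[OF F(1) G(1)] that
    by (cases "F w = 0"; cases "G v = 0") auto
qed

section \<open>Passing to a hyperplane\<close>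

lemma subspace_kernel: "continuous_functional F \<Longrightarrow> subspace {x. F x = 0}"
  by (rule subspaceI) (auto simp: continuous_functionalD)

lemma closed_kernel: "continuous_functional F \<Longrightarrow> closed {x. F x = 0}"
  by (intro closed_Collect_eq continuous_functionalD(3) continuous_on_const)

lemma kernel_component:
  assumes "continuous_functional F" "F v \<noteq> 0"
  shows "F (x - scale (F x / F v) v) = 0"
  using assms by (simp add: continuous_functionalD)

lemma finite_dimensional_basis:
  assumes "finite_dimensional_subspace A" "subspace V" "V \<subseteq> A"
  obtains B where "finite B" "B \<subseteq> V" "independent B" "span B = V" "card B = dim V"
proof -
  obtain C where C: "finite C" "span C = A"
    using assms(1) unfolding finite_dimensional_subspace_def by blast
  obtain B where B: "B \<subseteq> V" "independent B" "V \<subseteq> span B" "card B = dim V"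
    using basis_exists[of V] .
  moreover have "span B = V"
    using B span_minimal[OF B(1) assms(2)] by blast
  moreover have "finite B"
    using independent_span_bound[OF C(1) B(2)] B(1) C(2) assms(3) by blast
  ultimately show thesis using that by blast
qed

lemma finite_dimensional_eq_0_iff:
  assumes "finite_dimensional_subspace A"
  shows "dim A = 0 \<longleftrightarrow> A = {0}"
proof -
  have "subspace A" using assms by (simp add: finite_dimensional_subspace_def)
  then obtain B where B: "finite B" "independent B" "span B = A" "card B = dim A"
    using finite_dimensional_basis[OF assms] by blast
  show ?thesis
  proof
    assume "dim A = 0"
    then show "A = {0}" using B by auto
  next
    assume "A = {0}"
    then have "B \<subseteq> {0}" using span_superset[of B] B(3) by simp
    moreover have "0 \<notin> B" using B(2) dependent_zero by blast
    ultimately have "B = {}" by blast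
    then show "dim A = 0" using B(4) by simp
  qed
qed

lemma dim_Int_kernel:
  assumes A: "finite_dimensional_subspace A"
    and F: "continuous_functional F" and v: "v \<in> A" "F v \<noteq> 0"
  defines "N \<equiv> A \<inter> {x. F x = 0}"
  shows "finite_dimensional_subspace N" "dim A = Suc (dim N)"
proof -
  have sA: "subspace A" using A by (simp add: finite_dimensional_subspace_def)
  then have sN: "subspace N"
    unfolding N_def using subspace_kernel[OF F] by (rule subspace_inter)
  obtain B where B: "finite B" "B \<subseteq> N" "independent B" "span B = N" "card B = dim N"
    using finite_dimensional_basis[OF A sN] unfolding N_def by blast
  then show "finite_dimensional_subspace N"
    using sN by (auto simp: finite_dimensional_subspace_def)
  have vN: "v \<notin> N" using v by (simp add: N_def)
  have "dim A = card (insert v B)"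
  proof (rule dim_unique)
    show "insert v B \<subseteq> A" using B(2) v(1) by (auto simp: N_def)
    show "independent (insert v B)"
      using vN B by (intro independent_insertI) auto
    show "A \<subseteq> span (insert v B)"
    proof
      fix x assume "x \<in> A"
      then have "x - scale (F x / F v) v \<in> N"
        using kernel_component[OF F v(2)] v(1) sA
        by (auto simp: N_def intro: subspace_diff subspace_scale)
      then show "x \<in> span (insert v B)"
        unfolding span_breakdown_eq B(4) by blast
    qed
  qed simp
  then show "dim A = Suc (dim N)"
    using vN B by (metis card_insert_disjoint in_mono)
qed

text \<open>
  Complements are taken relative to a subspace \<open>H\<close>, since the induction descends through
  intersections of kernels.  A continuous projection is recorded instead of a homeomorphism because
  it can be written down explicitly when \<open>H\<close> grows.
\<close>

definition complement_in :: "'e set \<Rightarrow> 'e set \<Rightarrow> 'e set \<Rightarrow> bool" where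
  "complement_in H A R \<longleftrightarrow>
     subspace A \<and> subspace R \<and> closed R \<and> A \<subseteq> H \<and> R \<subseteq> H \<and> A \<inter> R = {0} \<and>
     (\<exists>P. continuous_on H P \<and> (\<forall>x\<in>H. P x \<in> A \<and> x - P x \<in> R))"

lemma complement_in_UNIV:
  assumes "complement_in UNIV A R"
  shows "topological_direct_sum A R"
proof -
  obtain P where P: "continuous_on UNIV P" "\<And>x. P x \<in> A" "\<And>x. x - P x \<in> R"
    and A: "subspace A" and R: "subspace R" "closed R" and int: "A \<inter> R = {0}"
    using assms unfolding complement_in_def by auto
  have P_sum: "P (a + r) = a" if "a \<in> A" "r \<in> R" for a r
  proof -
    have "(a + r - P (a + r)) - r \<in> R"
      using R(1) P(3) that(2) by (rule subspace_diff)
    moreover have "a - P (a + r) \<in> A"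
      using A that(1) P(2) by (rule subspace_diff)
    ultimately have "a - P (a + r) \<in> A \<inter> R" by (simp add: algebra_simps)
    then show ?thesis by (simp add: int)
  qed
  \<comment> \<open>\<open>A\<close> is closed as the set of fixed points of the projection.\<close>
  have "A = {x. P x = x}"
  proof (rule set_eqI)
    fix x
    show "x \<in> A \<longleftrightarrow> x \<in> {x. P x = x}"
      using P_sum[of x 0] P(2)[of x] subspace_0[OF R(1)] by auto
  qed
  moreover have "closed {x. P x = x}"
    by (intro closed_Collect_eq P continuous_on_id)
  ultimately have "closed A" by simp
  moreover have "homeomorphism (A \<times> R) UNIV (\<lambda>(a, b). a + b) (\<lambda>x. (P x, x - P x))"
  proof (rule homeomorphismI)
    show "continuous_on (A \<times> R) (\<lambda>(a, b). a + b)"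
      unfolding case_prod_beta by (intro continuous_intros)
    show "continuous_on UNIV (\<lambda>x. (P x, x - P x))"
      by (intro continuous_intros P)
  qed (use P P_sum in auto)
  ultimately show ?thesis
    using A R unfolding topological_direct_sum_def by blast
qed

lemma continuous_on_scale_left:
  assumes "continuous_on S c"
  shows "continuous_on S (\<lambda>x. scale (c x) v)"
proof -
  have "bounded_linear (\<lambda>a. scale a v)"
  proof (rule bounded_linear_intro[where K = "norm v"])
    show "scale (r *\<^sub>R a) v = r *\<^sub>R scale a v" for r a
      by (simp add: scaleR_conv_of_real flip: scale_scale scale_of_real)
  qed (simp_all add: scale_left_distrib norm_scale)
  then show ?thesis using assms by (rule bounded_linear.continuous_on)
qed

text \<open>
  Adding the line spanned by \<open>v\<close> to \<open>H \<inter> ker F\<close> and to \<open>A \<inter> ker F\<close> gives \<open>H\<close> and \<open>A\<close>, so that the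
  complement need not change.
\<close>

lemma complement_in_extend:
  assumes F: "continuous_functional F" and v: "v \<in> A" "F v \<noteq> 0"
    and A: "subspace A" "A \<subseteq> H" and H: "subspace H"
    and compl: "complement_in (H \<inter> {x. F x = 0}) (A \<inter> {x. F x = 0}) R"
  shows "complement_in H A R"
proof -
  obtain P where P: "continuous_on (H \<inter> {x. F x = 0}) P"
      "\<And>x. x \<in> H \<Longrightarrow> F x = 0 \<Longrightarrow> P x \<in> A" "\<And>x. x \<in> H \<Longrightarrow> F x = 0 \<Longrightarrow> x - P x \<in> R"
    and R: "subspace R" "closed R" "R \<subseteq> H" "R \<subseteq> {x. F x = 0}"
    and int: "A \<inter> {x. F x = 0} \<inter> R = {0}"
    using compl unfolding complement_in_def by auto
  define l where "l x = scale (F x / F v) v" for x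
  define Q where "Q x = l x + P (x - l x)" for x
  have l: "l x \<in> A" "F (x - l x) = 0" for x
    using v A kernel_component[OF F v(2)] by (auto simp: l_def intro: subspace_scale)
  then have xl: "x - l x \<in> H" if "x \<in> H" for x
    using that A(2) H by (auto intro: subspace_diff)
  \<comment> \<open>\<open>l\<close> projects onto the line of \<open>v\<close> along \<open>ker F\<close>; the old projection treats the rest.\<close>
  have "continuous_on H F"
    using continuous_functionalD(3)[OF F] by (rule continuous_on_subset) simp
  then have cl: "continuous_on H l"
    unfolding l_def using v(2) by (intro continuous_on_scale_left continuous_intros) auto
  have "continuous_on H (\<lambda>x. P (x - l x))"
    using xl l by (intro continuous_on_compose2[OF P(1)] continuous_intros cl) auto
  then have "continuous_on H Q"
    unfolding Q_def by (intro continuous_on_add cl)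
  moreover have "Q x \<in> A \<and> x - Q x \<in> R" if "x \<in> H" for x
    using P(2,3)[OF xl[OF that] l(2)] l(1)[of x] A(1)
    by (auto simp: Q_def diff_diff_eq intro: subspace_add)
  moreover have "A \<inter> R = {0}" using int R(4) by blast
  ultimately show ?thesis
    using A R unfolding complement_in_def by blast
qed

section \<open>Common complements\<close>

text \<open>
  The induction varies \<open>H\<close>: a common complement inside \<open>H \<inter> ker F\<close> already serves inside \<open>H\<close>, and in
  dimension zero \<open>H\<close> itself is the complement.
\<close>

lemma common_complement_in:
  assumes "finite_dimensional_subspace A" "finite_dimensional_subspace B" "dim A = dim B"
    and "subspace H" "closed H" "A \<subseteq> H" "B \<subseteq> H"
  shows "\<exists>R. complement_in H A R \<and> complement_in H B R"
  using assms
proof (induction "dim A" arbitrary: A B H)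
  case 0
  then have "A = {0}" "B = {0}"
    using finite_dimensional_eq_0_iff by metis+
  moreover have "complement_in H {0} H"
    using 0 unfolding complement_in_def
    by (auto simp: subspace_0 subspace_single_0 intro!: exI[of _ "\<lambda>_. 0"])
  ultimately show ?case by blast
next
  case (Suc n)
  have sub: "subspace A" "subspace B"
    using Suc.prems by (auto simp: finite_dimensional_subspace_def)
  have "A \<noteq> {0}" "B \<noteq> {0}"
    using Suc finite_dimensional_eq_0_iff by (metis nat.distinct(1))+
  then obtain v w where vw: "v \<in> A" "v \<noteq> 0" "w \<in> B" "w \<noteq> 0"
    using sub subspace_0 by blast
  obtain F where F: "continuous_functional F" "F v \<noteq> 0" "F w \<noteq> 0"
    using ex_continuous_functional_two[OF vw(2,4)] .
  let ?N = "{x. F x = 0}"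
  note dA = dim_Int_kernel[OF Suc.prems(1) F(1) vw(1) F(2)]
  note dB = dim_Int_kernel[OF Suc.prems(2) F(1) vw(3) F(3)]
  have "\<exists>R. complement_in (H \<inter> ?N) (A \<inter> ?N) R \<and> complement_in (H \<inter> ?N) (B \<inter> ?N) R"
  proof (rule Suc.hyps(1))
    show "n = dim (A \<inter> ?N)" "dim (A \<inter> ?N) = dim (B \<inter> ?N)"
      using dA(2) dB(2) Suc.hyps(2) Suc.prems(3) by auto
    show "subspace (H \<inter> ?N)"
      using Suc.prems(4) subspace_kernel[OF F(1)] by (rule subspace_inter)
    show "closed (H \<inter> ?N)"
      using Suc.prems(5) closed_kernel[OF F(1)] by (rule closed_Int)
  qed (use dA dB Suc.prems in auto)
  then show ?case
    using complement_in_extend[OF F(1) vw(1) F(2) sub(1)]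
      complement_in_extend[OF F(1) vw(3) F(3) sub(2)] Suc.prems by blast
qed

end

theorem theorem1p5:
  fixes scale :: "'k::{real_normed_field,euclidean_space} \<Rightarrow> 'e::banach \<Rightarrow> 'e"
    and E1 E2 :: "'e set"
  assumes "banach_space_over scale"
    and "banach_space_over.finite_dimensional_subspace scale E1"
    and "banach_space_over.finite_dimensional_subspace scale E2"
    and "vector_space.dim scale E1 = vector_space.dim scale E2"
  shows "\<exists>R. banach_space_over.topological_direct_sum scale E1 R \<and>
             banach_space_over.topological_direct_sum scale E2 R"
proof -
  interpret banach_space_over scale by fact
  show ?thesis
    using common_complement_in[OF assms(2-4), of UNIV] complement_in_UNIV by auto
qed

end
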